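(* Let $C,D$ be constructors and $v,w$ values. If $C\neq D$ then $C[v]\not\equiv D[w]$.
   Context: Fix pairwise disjoint countably infinite sets of $\lambda$-variables ($x,y,\dots$), stack variables ($\alpha,\beta,\dots$), term variables ($a,b,\dots$), and countable sets of labels $l$ and constructors $C$. Values, terms, stacks, processes: $v,w::=x\mid\lambda x\,t\mid C[v]\mid\{l_i=v_i\}_{i\in I}$; $t,u::=a\mid v\mid t\,u\mid\mu\alpha\,t\mid p\mid v.l\mid\mathrm{case}_v[C_i[x_i]\to t_i]_{i\in I}\mid\delta_{v,w}$; $\pi::=\alpha\mid v.\pi\mid[t]\pi$; $p::=t\ast\pi$; $I$ finite; $\lambda x$, $\mu\alpha$ and the $x_i$ in case branches are binders, term variables are never bound. Substitutions map $\lambda$-variables to values, stack variables to stacks, term variables to terms (capture-avoiding). $\succ$ is the smallest relation on processes with: $t\,u\ast\pi\succ u\ast[t]\pi$; $v\ast[t]\pi\succ t\ast v.\pi$; $\lambda x\,t\ast v.\pi\succ t[x:=v]\ast\pi$; $\mu\alpha\,t\ast\pi\succ t[\alpha:=\pi]\ast\pi$; $p\ast\pi\succ p$; $\{l_i=v_i\}_{i\in I}.l_k\ast\pi\succ v_k\ast\pi$ ($k\in I$); $\mathrm{case}_{C_k[v]}[C_i[x_i]\to t_i]_{i\in I}\ast\pi\succ t_k[x_k:=v]\ast\pi$ ($k\in I$). A process is final if it is $v\ast\alpha$ with $v$ a value and $\alpha$ a stack variable; for a relation $R$, $p\Downarrow_R$ means $p\,R^*\,q$ with $q$ final. For $i\in\mathbb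 N$, inductively: $\rightsquigarrow_i=\succ\cup\{(\delta_{v,w}\ast\pi,v\ast\pi)\mid\exists j<i,\ v\not\equiv_jw\}$; $t\equiv_iu$ iff for all $j\le i$, stacks $\pi$, substitutions $\sigma$: $t\sigma\ast\pi\Downarrow_{\rightsquigarrow_j}\Leftrightarrow u\sigma\ast\pi\Downarrow_{\rightsquigarrow_j}$; $\not\equiv_i$ is its negation. $\equiv=\bigcap_i\equiv_i$ and $\not\equiv$ is its negation. *)

theory Defs
  imports Main "HOL-Library.Countable" "HOL-Library.Finite_Map"
begin

text \<open>
  Syntax up to renaming of bound variables, in de Bruijn style. There are two independent index
  spaces: lambda-variables (bound by \<open>Lam\<close> and by each branch of \<open>Case\<close>) and stack variables
  (bound by \<open>Mu\<close>). Term variables are never bound, so they are plain names. Values and processes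
  occur as terms via \<open>Val\<close> and \<open>Proc\<close>. A family indexed by a finite set with distinct labels
  (constructors) is a finite map.
\<close>

datatype ('l, 'c) val =
    VVar nat
  | Lam "('l, 'c) trm"
  | Con 'c "('l, 'c) val"
  | Rec "('l, ('l, 'c) val) fmap"
and ('l, 'c) trm =
    TVar nat
  | Val "('l, 'c) val"
  | App "('l, 'c) trm" "('l, 'c) trm"
  | Mu "('l, 'c) trm"
  | Proc "('l, 'c) proc"
  | Proj "('l, 'c) val" 'l
  | Case "('l, 'c) val" "('c, ('l, 'c) trm) fmap"
  | Delta "('l, 'c) val" "('l, 'c) val"
and ('l, 'c) stk =
    SVar nat
  | Push "('l, 'c) val" "('l, 'c) stk"
  | Frame "('l, 'c) trm" "('l, 'c) stk"
and ('l, 'c) proc =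
    Cut "('l, 'c) trm" "('l, 'c) stk"

definition up :: "(nat \<Rightarrow> nat) \<Rightarrow> nat \<Rightarrow> nat" where
  "up f = case_nat 0 (\<lambda>n. Suc (f n))"

text \<open>Renaming of free variables: \<open>f\<close> acts on lambda-variables and \<open>g\<close> on stack variables.\<close>

primrec ren_val :: "('l, 'c) val \<Rightarrow> (nat \<Rightarrow> nat) \<Rightarrow> (nat \<Rightarrow> nat) \<Rightarrow> ('l, 'c) val"
  and ren_trm :: "('l, 'c) trm \<Rightarrow> (nat \<Rightarrow> nat) \<Rightarrow> (nat \<Rightarrow> nat) \<Rightarrow> ('l, 'c) trm"
  and ren_stk :: "('l, 'c) stk \<Rightarrow> (nat \<Rightarrow> nat) \<Rightarrow> (nat \<Rightarrow> nat) \<Rightarrow> ('l, 'c) stk"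
  and ren_proc :: "('l, 'c) proc \<Rightarrow> (nat \<Rightarrow> nat) \<Rightarrow> (nat \<Rightarrow> nat) \<Rightarrow> ('l, 'c) proc"
where
  "ren_val (VVar x) f g = VVar (f x)"
| "ren_val (Lam t) f g = Lam (ren_trm t (up f) g)"
| "ren_val (Con C v) f g = Con C (ren_val v f g)"
| "ren_val (Rec r) f g = Rec (fmmap (\<lambda>v. ren_val v f g) r)"
| "ren_trm (TVar a) f g = TVar a"
| "ren_trm (Val v) f g = Val (ren_val v f g)"
| "ren_trm (App t u) f g = App (ren_trm t f g) (ren_trm u f g)"
| "ren_trm (Mu t) f g = Mu (ren_trm t f (up g))"
| "ren_trm (Proc p) f g = Proc (ren_proc p f g)"
| "ren_trm (Proj v l) f g = Proj (ren_val v f g) l"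
| "ren_trm (Case v B) f g = Case (ren_val v f g) (fmmap (\<lambda>t. ren_trm t (up f) g) B)"
| "ren_trm (Delta v w) f g = Delta (ren_val v f g) (ren_val w f g)"
| "ren_stk (SVar \<alpha>) f g = SVar (g \<alpha>)"
| "ren_stk (Push v \<pi>) f g = Push (ren_val v f g) (ren_stk \<pi> f g)"
| "ren_stk (Frame t \<pi>) f g = Frame (ren_trm t f g) (ren_stk \<pi> f g)"
| "ren_proc (Cut t \<pi>) f g = Cut (ren_trm t f g) (ren_stk \<pi> f g)"

text \<open>
  A substitution consists of three total maps. As every expression has only finitely many free
  variables, maps of infinite support yield no instances beyond those of finite support.
\<close>

record ('l, 'c) subst =
  on_val :: "nat \<Rightarrow> ('l, 'c) val"
  on_stk :: "nat \<Rightarrow> ('l, 'c) stk"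
  on_trm :: "nat \<Rightarrow> ('l, 'c) trm"

definition id_subst :: "('l, 'c) subst" where
  "id_subst = \<lparr>on_val = VVar, on_stk = SVar, on_trm = TVar\<rparr>"

text \<open>Passing under a binder for a lambda-variable, respectively a stack variable.\<close>

definition lift_lam :: "('l, 'c) subst \<Rightarrow> ('l, 'c) subst" where
  "lift_lam \<sigma> =
    \<lparr>on_val = case_nat (VVar 0) (\<lambda>n. ren_val (on_val \<sigma> n) Suc id),
     on_stk = (\<lambda>n. ren_stk (on_stk \<sigma> n) Suc id),
     on_trm = (\<lambda>n. ren_trm (on_trm \<sigma> n) Suc id)\<rparr>"

definition lift_mu :: "('l, 'c) subst \<Rightarrow> ('l, 'c) subst" where
  "lift_mu \<sigma> =
    \<lparr>on_val = (\<lambda>n. ren_val (on_val \<sigma> n) id Suc),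
     on_stk = case_nat (SVar 0) (\<lambda>n. ren_stk (on_stk \<sigma> n) id Suc),
     on_trm = (\<lambda>n. ren_trm (on_trm \<sigma> n) id Suc)\<rparr>"

primrec subst_val :: "('l, 'c) val \<Rightarrow> ('l, 'c) subst \<Rightarrow> ('l, 'c) val"
  and subst_trm :: "('l, 'c) trm \<Rightarrow> ('l, 'c) subst \<Rightarrow> ('l, 'c) trm"
  and subst_stk :: "('l, 'c) stk \<Rightarrow> ('l, 'c) subst \<Rightarrow> ('l, 'c) stk"
  and subst_proc :: "('l, 'c) proc \<Rightarrow> ('l, 'c) subst \<Rightarrow> ('l, 'c) proc"
where
  "subst_val (VVar x) \<sigma> = on_val \<sigma> x"
| "subst_val (Lam t) \<sigma> = Lam (subst_trm t (lift_lam \<sigma>))"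
| "subst_val (Con C v) \<sigma> = Con C (subst_val v \<sigma>)"
| "subst_val (Rec r) \<sigma> = Rec (fmmap (\<lambda>v. subst_val v \<sigma>) r)"
| "subst_trm (TVar a) \<sigma> = on_trm \<sigma> a"
| "subst_trm (Val v) \<sigma> = Val (subst_val v \<sigma>)"
| "subst_trm (App t u) \<sigma> = App (subst_trm t \<sigma>) (subst_trm u \<sigma>)"
| "subst_trm (Mu t) \<sigma> = Mu (subst_trm t (lift_mu \<sigma>))"
| "subst_trm (Proc p) \<sigma> = Proc (subst_proc p \<sigma>)"
| "subst_trm (Proj v l) \<sigma> = Proj (subst_val v \<sigma>) l"
| "subst_trm (Case v B) \<sigma> = Case (subst_val v \<sigma>) (fmmap (\<lambda>t. subst_trm t (lift_lam \<sigma>)) B)"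
| "subst_trm (Delta v w) \<sigma> = Delta (subst_val v \<sigma>) (subst_val w \<sigma>)"
| "subst_stk (SVar \<alpha>) \<sigma> = on_stk \<sigma> \<alpha>"
| "subst_stk (Push v \<pi>) \<sigma> = Push (subst_val v \<sigma>) (subst_stk \<pi> \<sigma>)"
| "subst_stk (Frame t \<pi>) \<sigma> = Frame (subst_trm t \<sigma>) (subst_stk \<pi> \<sigma>)"
| "subst_proc (Cut t \<pi>) \<sigma> = Cut (subst_trm t \<sigma>) (subst_stk \<pi> \<sigma>)"

text \<open>
  Instantiating the variable of a removed binder: index \<open>0\<close> is replaced and the remaining
  indices of the same kind are decremented.
\<close>

definition inst_lam :: "('l, 'c) trm \<Rightarrow> ('l, 'c) val \<Rightarrow> ('l, 'c) trm" where
  "inst_lam t v = subst_trm t (id_subst\<lparr>on_val := case_nat v VVar\<rparr>)"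

definition inst_mu :: "('l, 'c) trm \<Rightarrow> ('l, 'c) stk \<Rightarrow> ('l, 'c) trm" where
  "inst_mu t \<pi> = subst_trm t (id_subst\<lparr>on_stk := case_nat \<pi> SVar\<rparr>)"

inductive step :: "('l, 'c) proc \<Rightarrow> ('l, 'c) proc \<Rightarrow> bool" where
  "step (Cut (App t u) \<pi>) (Cut u (Frame t \<pi>))"
| "step (Cut (Val v) (Frame t \<pi>)) (Cut t (Push v \<pi>))"
| "step (Cut (Val (Lam t)) (Push v \<pi>)) (Cut (inst_lam t v) \<pi>)"
| "step (Cut (Mu t) \<pi>) (Cut (inst_mu t \<pi>) \<pi>)"
| "step (Cut (Proc p) \<pi>) p"
| "fmlookup r l = Some v \<Longrightarrow> step (Cut (Proj (Rec r) l) \<pi>) (Cut (Val v) \<pi>)"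
| "fmlookup B C = Some t \<Longrightarrow> step (Cut (Case (Con C v) B) \<pi>) (Cut (inst_lam t v) \<pi>)"

definition final :: "('l, 'c) proc \<Rightarrow> bool" where
  "final p \<longleftrightarrow> (\<exists>v \<alpha>. p = Cut (Val v) (SVar \<alpha>))"

definition converges ::
  "(('l, 'c) proc \<Rightarrow> ('l, 'c) proc \<Rightarrow> bool) \<Rightarrow> ('l, 'c) proc \<Rightarrow> bool" where
  "converges R p \<longleftrightarrow> (\<exists>q. R\<^sup>*\<^sup>* p q \<and> final q)"

text \<open>
  Simultaneous recursion on the level: \<open>red i\<close> uses \<open>equiv_at j\<close> for \<open>j < i\<close> only, while
  \<open>equiv_at i\<close> uses \<open>red j\<close> for \<open>j \<le> i\<close>.
\<close>

function red :: "nat \<Rightarrow> ('l, 'c) proc \<Rightarrow> ('l, 'c) proc \<Rightarrow> bool"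
  and equiv_at :: "nat \<Rightarrow> ('l, 'c) trm \<Rightarrow> ('l, 'c) trm \<Rightarrow> bool"
where
  "red i = (\<lambda>p q. step p q \<or>
     (\<exists>v w \<pi>. p = Cut (Delta v w) \<pi> \<and> q = Cut (Val v) \<pi> \<and>
       (\<exists>j\<in>{..<i}. \<not> equiv_at j (Val v) (Val w))))"
| "equiv_at i = (\<lambda>t u. \<forall>j\<in>{..i}. \<forall>\<pi> \<sigma>.
     converges (red j) (Cut (subst_trm t \<sigma>) \<pi>) \<longleftrightarrow>
     converges (red j) (Cut (subst_trm u \<sigma>) \<pi>))"
  by pat_completeness auto
termination
  by (relation "measure (case_sum (\<lambda>i. 2 * i) (\<lambda>i. 2 * i + 1))") auto

declare red.simps [simp del] equiv_at.simps [simp del]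

definition equivalent :: "('l, 'c) trm \<Rightarrow> ('l, 'c) trm \<Rightarrow> bool" where
  "equivalent t u \<longleftrightarrow> (\<forall>i. equiv_at i t u)"

end

theory Submission imports Defs begin

text \<open>
  The stack \<open>[\<lambda>x. case\<^sub>x [C[x] \<rightarrow> x]]\<alpha>\<close> separates the two values at level 0, whatever the
  substitution: cut against \<open>C[v]\<close> it reduces to \<open>v \<ast> \<alpha>\<close>, while cut against \<open>D[w]\<close> it reduces
  only to a case analysis without matching branch, which is stuck.
\<close>

definition tester :: "'c \<Rightarrow> ('l, 'c) val" where
  "tester C = Lam (Case (VVar 0) (fmupd C (Val (VVar 0)) fmempty))"

text \<open>No natural number is below 0, so the \<open>Delta\<close> rule is void at level
  0.\<close>

lemma red_0: "red 0 = step"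
  by (simp add: red.simps fun_eq_iff)

lemma converges_tester:
  "converges step (Cut (Val (Con C v)) (Frame (Val (tester C)) (SVar \<alpha>)))"
proof -
  let ?p = "Cut (Case (Con C v) (fmupd C (Val (VVar 0)) fmempty)) (SVar \<alpha>)"
  have "step (Cut (Val (Con C v)) (Frame (Val (tester C)) (SVar \<alpha>)))
      (Cut (Val (tester C)) (Push (Con C v) (SVar \<alpha>)))"
    by (rule step.intros)
  \<comment> \<open>Substituting \<open>Con C v\<close> leaves the branch unchanged: its
    \<open>VVar 0\<close> is bound by the branch itself and fixed by
    \<open>lift_lam\<close>.\<close>
  also have "step\<^sup>*\<^sup>* \<dots> ?p"
    using step.intros(3)[of "Case (VVar 0) (fmupd C (Val (VVar 0)) fmempty)" "Con C v" "SVar \<alpha>"]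
    by (auto simp: tester_def inst_lam_def lift_lam_def fmmap_fmupd)
  also have "step ?p (Cut (inst_lam (Val (VVar 0)) v) (SVar \<alpha>))"
    by (rule step.intros) simp
  finally show ?thesis
    unfolding converges_def final_def by (auto simp: inst_lam_def)
qed

lemma not_converges_tester:
  assumes "C \<noteq> D"
  shows "\<not> converges step (Cut (Val (Con D w)) (Frame (Val (tester C)) \<pi>))"
proof -
  let ?t = "Val (tester C)" and ?B = "fmupd C (Val (VVar 0)) fmempty"
  \<comment> \<open>These three processes are closed under \<open>step\<close>, the last being stuck
    as \<open>C \<noteq> D\<close>, and none is final.\<close>
  have "q \<in> {Cut (Val (Con D w)) (Frame ?t \<pi>), Cut ?t (Push (Con D w) \<pi>), Cut (Case (Con D w) ?B) \<pi>}"
    if "step\<^sup>*\<^sup>* (Cut (Val (Con D w)) (Frame ?t \<pi>)) q" for q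
    using that assms
    by induction (auto elim!: step.cases simp: tester_def inst_lam_def lift_lam_def fmmap_fmupd)
  then show ?thesis
    unfolding converges_def final_def by blast
qed

theorem theorem11:
  fixes C D :: "'c::countable"
    and v w :: "('l::countable, 'c) val"
  assumes "C \<noteq> D"
  shows "\<not> equivalent (Val (Con C v)) (Val (Con D w))"
proof
  let ?\<pi> = "Frame (Val (tester C)) (SVar 0) :: ('l, 'c) stk"
  assume "equivalent (Val (Con C v)) (Val (Con D w))"
  \<comment> \<open>Any substitution would do in place of \<open>id_subst\<close>, since it keeps
    the constructors \<open>C\<close> and \<open>D\<close>.\<close>
  then have "converges step (Cut (subst_trm (Val (Con C v)) id_subst) ?\<pi>) \<longleftrightarrow>
      converges step (Cut (subst_trm (Val (Con D w)) id_subst) ?\<pi>)"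
    unfolding equivalent_def equiv_at.simps by (metis atMost_iff order_refl red_0)
  then show False
    by (simp add: converges_tester not_converges_tester[OF assms])
qed

end
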